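(* Let $H\in\mathbb{R}$ and let $Y=\{Y(\mu;t):\mu\in\overline\Omega,t\ge0\}$ be a family of stochastic processes. For a family $X=\{X(\mu;t):\mu\in\overline\Omega,t\ge0\}$ consider the condition $$c^{-H}X(\mu c^{H-1};ct)\overset{d}{\rightarrow}Y(\mu;t)\ \text{ for } t\ge0,\quad\text{as } c\to\infty\ \text{ or as } c\downarrow0,\qquad(\ast)$$ for every $\mu\in\overline\Omega$, where $\overset d\to$ denotes convergence of the finite-dimensional distributions of the processes in $t$. 1. If there exists a family of stochastic processes $X$ such that $(\ast)$ holds (in one of the two limits $c\to\infty$ or $c\downarrow0$), then $Y$ is self-similar with Hurst exponent $H$, i.e. for each $\mu\in\overline\Omega$ and all $c>0$, $\{Y(\mu c^{H-1};ct)\}_{t\ge0}\overset d=\{c^HY(\mu;t)\}_{t\ge0}$. 2. If $Y$ is self-similar with Hurst exponent $H$, then there exists a family $X$ satisfying $(\ast)$.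
   Context: Families of processes are real-valued and indexed by $\mu\in\overline\Omega$, where $\overline\Omega$ is an interval (possibly containing $\pm\infty$) with $\mathbb{R}_+\subseteq\overline\Omega$ and $c\,\overline\Omega\subseteq\overline\Omega$ for all $c>0$. The symbol $\overset d=$ denotes equality of finite-dimensional distributions. *)

theory Defs
  imports "HOL-Probability.Probability"
begin

text \<open>
  Parameter sets of families: intervals of extended reals that contain all positive reals and are
  closed under multiplication by positive reals. Only the open half-line of positive reals is
  required to be contained, so that both conventions about 0 in the notation for the positive
  half-line are covered.
\<close>

definition index_interval :: "ereal set \<Rightarrow> bool" where
  "index_interval \<Omega> \<longleftrightarrow>
     (\<forall>a\<in>\<Omega>. \<forall>b\<in>\<Omega>. {a..b} \<subseteq> \<Omega>) \<and>
     ereal ` {0<..} \<subseteq> \<Omega> \<and>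
     (\<forall>c>0. (\<lambda>\<mu>. ereal c * \<mu>) ` \<Omega> \<subseteq> \<Omega>)"

text \<open>
  The process with parameter \<open>\<mu>\<close> lives on its own probability space \<open>M \<mu>\<close>; a family on one common
  space is the case of a constant \<open>M\<close>. Values at \<open>\<mu> \<notin> \<Omega>\<close> or \<open>t < 0\<close> are irrelevant.
\<close>

definition process_family ::
    "ereal set \<Rightarrow> (ereal \<Rightarrow> 'a measure) \<Rightarrow> (ereal \<Rightarrow> real \<Rightarrow> 'a \<Rightarrow> real) \<Rightarrow> bool" where
  "process_family \<Omega> M Y \<longleftrightarrow>
     (\<forall>\<mu>\<in>\<Omega>. prob_space (M \<mu>) \<and> (\<forall>t\<ge>0. Y \<mu> t \<in> borel_measurable (M \<mu>)))"

text \<open>The joint law of \<open>(Z t)\<close>, \<open>t \<in> J\<close>, for a finite set \<open>J\<close> of times.\<close>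

definition fdd :: "'a measure \<Rightarrow> (real \<Rightarrow> 'a \<Rightarrow> real) \<Rightarrow> real set \<Rightarrow> (real \<Rightarrow> real) measure" where
  "fdd M Z J = distr M (PiM J (\<lambda>_. borel)) (\<lambda>\<omega>. \<lambda>t\<in>J. Z t \<omega>)"

definition fdd_eq ::
    "'a measure \<Rightarrow> (real \<Rightarrow> 'a \<Rightarrow> real) \<Rightarrow> 'b measure \<Rightarrow> (real \<Rightarrow> 'b \<Rightarrow> real) \<Rightarrow> bool" where
  "fdd_eq M Z M' Z' \<longleftrightarrow> (\<forall>J. finite J \<and> J \<subseteq> {0..} \<longrightarrow> fdd M Z J = fdd M' Z' J)"

text \<open>
  Weak convergence along a filter, for measures on the Borel sets of a topology (the library's
  \<open>weak_conv_m\<close> only covers sequences of measures on the real line).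
\<close>

definition weak_conv_on ::
    "'a topology \<Rightarrow> ('i \<Rightarrow> 'a measure) \<Rightarrow> 'a measure \<Rightarrow> 'i filter \<Rightarrow> bool" where
  "weak_conv_on T P Q F \<longleftrightarrow>
     (\<forall>f. continuous_map T euclideanreal f \<and> bounded (f ` topspace T) \<longrightarrow>
        ((\<lambda>i. \<integral>x. f x \<partial>P i) \<longlongrightarrow> (\<integral>x. f x \<partial>Q)) F)"

definition fdd_conv ::
    "('i \<Rightarrow> 'a measure) \<Rightarrow> ('i \<Rightarrow> real \<Rightarrow> 'a \<Rightarrow> real) \<Rightarrow>
     'b measure \<Rightarrow> (real \<Rightarrow> 'b \<Rightarrow> real) \<Rightarrow> 'i filter \<Rightarrow> bool" where
  "fdd_conv N Z M Y F \<longleftrightarrow>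
     (\<forall>J. finite J \<and> J \<subseteq> {0..} \<longrightarrow>
        weak_conv_on (product_topology (\<lambda>_. euclideanreal) J)
          (\<lambda>i. fdd (N i) (Z i) J) (fdd M Y J) F)"

definition self_similar ::
    "real \<Rightarrow> ereal set \<Rightarrow> (ereal \<Rightarrow> 'a measure) \<Rightarrow> (ereal \<Rightarrow> real \<Rightarrow> 'a \<Rightarrow> real) \<Rightarrow> bool" where
  "self_similar H \<Omega> M Y \<longleftrightarrow>
     (\<forall>\<mu>\<in>\<Omega>. \<forall>c>0.
        fdd_eq (M (\<mu> * ereal (c powr (H - 1)))) (\<lambda>t. Y (\<mu> * ereal (c powr (H - 1))) (c * t))
               (M \<mu>) (\<lambda>t \<omega>. c powr H * Y \<mu> t \<omega>))"

definition lamperti_conv ::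
    "real \<Rightarrow> ereal set \<Rightarrow> (ereal \<Rightarrow> 'a measure) \<Rightarrow> (ereal \<Rightarrow> real \<Rightarrow> 'a \<Rightarrow> real) \<Rightarrow>
     (ereal \<Rightarrow> 'b measure) \<Rightarrow> (ereal \<Rightarrow> real \<Rightarrow> 'b \<Rightarrow> real) \<Rightarrow> real filter \<Rightarrow> bool" where
  "lamperti_conv H \<Omega> N X M Y F \<longleftrightarrow>
     (\<forall>\<mu>\<in>\<Omega>.
        fdd_conv (\<lambda>c. N (\<mu> * ereal (c powr (H - 1))))
          (\<lambda>c t \<omega>. c powr (- H) * X (\<mu> * ereal (c powr (H - 1))) (c * t) \<omega>)
          (M \<mu>) (Y \<mu>) F)"

end

theory Submission
  imports Defs
begin

text \<open>
  Since \<open>F\<close> is invariant under \<open>c \<mapsto> a c\<close>, the limit at parameter \<open>\<mu> a\<^bsup>H-1\<^esup>\<close> and times \<open>a t\<close>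
  and \<open>a\<^bsup>H\<^esup>\<close> times the limit at parameter \<open>\<mu>\<close> and times \<open>t\<close> are weak limits of the same laws,
  so they agree by uniqueness of weak limits. Conversely, a self-similar \<open>Y\<close> serves as its own
  \<open>X\<close>: the rescaled laws do not depend on \<open>c\<close>.
\<close>

section \<open>Open sets and continuous functions on finite products of the real line\<close>

text \<open>Second countability: around each point of \<open>U\<close> an open box with rational end
  points fits inside \<open>U\<close>. For finite \<open>J\<close> there are only countably many
  such boxes, and each of them is measurable.\<close>

lemma sets_PiM_openin_product_topology:
  assumes J: "finite J" and U: "openin (product_topology (\<lambda>_. euclideanreal) J) U"
  shows "U \<in> sets (PiM J (\<lambda>_. borel :: real measure))"
proof -
  define B where "B = PiE J (\<lambda>_. (\<rat> :: real set))"
  define R where "R p = PiE J (\<lambda>j. {fst p j<..<snd p j})" for p :: "('a \<Rightarrow> real) \<times> ('a \<Rightarrow> real)"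
  have "\<exists>p\<in>B \<times> B. x \<in> R p \<and> R p \<subseteq> U" if x: "x \<in> U" for x
  proof -
    obtain V where V: "\<And>j. j \<in> J \<Longrightarrow> open (V j)" "x \<in> PiE J V" "PiE J V \<subseteq> U"
      using U x unfolding openin_product_topology_alt by (metis open_openin)
    have "\<exists>a b. a \<in> \<rat> \<and> b \<in> \<rat> \<and> a < x j \<and> x j < b \<and> {a<..<b} \<subseteq> V j" if j: "j \<in> J" for j
    proof -
      obtain e where e: "e > 0" "ball (x j) e \<subseteq> V j"
        using V(1,2) j by (meson PiE_mem openE)
      obtain a where "a \<in> \<rat>" "x j - e < a" "a < x j"
        using Rats_dense_in_real[of "x j - e" "x j"] e by auto
      moreover obtain b where "b \<in> \<rat>" "x j < b" "b < x j + e"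
        using Rats_dense_in_real[of "x j" "x j + e"] e by auto
      ultimately show ?thesis
        using e by (intro exI[of _ a] exI[of _ b]) (auto simp: subset_eq dist_real_def)
    qed
    then obtain a b where ab: "\<And>j. j \<in> J \<Longrightarrow>
        a j \<in> \<rat> \<and> b j \<in> \<rat> \<and> a j < x j \<and> x j < b j \<and> {a j<..<b j} \<subseteq> V j"
      by metis
    \<comment> \<open>The end points are cut down to \<open>J\<close> because only extensional
      functions form the countable set \<open>B\<close>.\<close>
    have "(restrict a J, restrict b J) \<in> B \<times> B"
      using ab by (auto simp: B_def)
    moreover have "x \<in> R (restrict a J, restrict b J)"
      using ab V(2) by (auto simp: R_def PiE_iff)
    moreover have "R (restrict a J, restrict b J) \<subseteq> PiE J V"
      unfolding R_def using ab by (intro PiE_mono) auto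
    ultimately show ?thesis
      using V(3) by blast
  qed
  then have U_eq: "U = (\<Union>p\<in>{p \<in> B \<times> B. R p \<subseteq> U}. R p)"
    by blast
  have "countable B"
    unfolding B_def using J countable_rat by (intro countable_PiE) auto
  then have "countable {p \<in> B \<times> B. R p \<subseteq> U}"
    by (intro countable_Collect countable_SIGMA)
  moreover have "R p \<in> sets (PiM J (\<lambda>_. borel))" for p
    unfolding R_def using J by (intro sets_PiM_I_finite) auto
  ultimately show ?thesis
    by (subst U_eq) (intro sets.countable_UN'', auto)
qed

text \<open>Makes the test functions of \<open>weak_conv_on\<close> measurable for joint laws. A
  non-measurable integrand would have the default integral 0, and its integral would say nothing
  about the law.\<close>

lemma borel_measurable_continuous_map_product:
  assumes "finite J" and f: "continuous_map (product_topology (\<lambda>_. euclideanreal) J) euclideanreal f"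
  shows "f \<in> borel_measurable (PiM J (\<lambda>_. borel :: real measure))"
proof (rule borel_measurableI)
  fix S :: "real set"
  assume "open S"
  with f have "openin (product_topology (\<lambda>_. euclideanreal) J)
      {x \<in> topspace (product_topology (\<lambda>_. euclideanreal) J). f x \<in> S}"
    by (intro openin_continuous_map_preimage) auto
  moreover have "{x \<in> topspace (product_topology (\<lambda>_. euclideanreal) J). f x \<in> S} =
      f -` S \<inter> space (PiM J (\<lambda>_. borel :: real measure))"
    by (auto simp: space_PiM)
  ultimately show "f -` S \<inter> space (PiM J (\<lambda>_. borel :: real measure)) \<in> sets (PiM J (\<lambda>_. borel))"
    using sets_PiM_openin_product_topology[OF \<open>finite J\<close>] by metis
qed

section \<open>Laws determined by their integrals of bounded continuous functions\<close>

text \<open>Closed boxes are chosen as generator because they are stable under intersection and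
  their indicators are limits of continuous functions.\<close>

lemma sets_PiM_borel_eq_closed_boxes:
  assumes J: "finite J"
  shows "sets (PiM J (\<lambda>_. borel :: real measure)) =
    sigma_sets (PiE J (\<lambda>_. UNIV)) {PiE J C | C. \<forall>j\<in>J. closed (C j)}"
    (is "sets ?P = sigma_sets ?S ?E")
proof
  have E: "?E \<subseteq> Pow ?S"
    by (auto simp: PiE_iff)
  \<comment> \<open>Measurability of the identity is the inclusion of the product sigma-algebra in
    the generated one, and it can be checked one coordinate at a time.\<close>
  have *: "(\<lambda>x. x) \<in> measurable (sigma ?S ?E) ?P"
  proof (rule measurable_PiM_single')
    show "(\<lambda>x. x) \<in> space (sigma ?S ?E) \<rightarrow> PiE J (\<lambda>_. space borel)"
      using E by (simp add: space_measure_of)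
  next
    fix j assume j: "j \<in> J"
    show "(\<lambda>x. x j) \<in> borel_measurable (sigma ?S ?E)"
      unfolding borel_eq_closed
    proof (rule measurable_sigma_sets)
      fix C :: "real set" assume "C \<in> Collect closed"
      \<comment> \<open>A cylinder over a closed set is a closed box whose other sides are the whole
        line.\<close>
      then have "PiE J (\<lambda>i. if i = j then C else UNIV) \<in> ?E"
        by (intro CollectI exI[of _ "\<lambda>i. if i = j then C else UNIV"]) auto
      moreover have "PiE J (\<lambda>i. if i = j then C else UNIV) =
          (\<lambda>x. x j) -` C \<inter> space (sigma ?S ?E)"
        using E j by (auto simp: space_measure_of PiE_iff split: if_splits)
      ultimately show "(\<lambda>x. x j) -` C \<inter> space (sigma ?S ?E) \<in> sets (sigma ?S ?E)"
        using E by (metis (lifting) sets_measure_of sigma_sets.Basic)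
    qed auto
  qed
  show "sets ?P \<subseteq> sigma_sets ?S ?E"
  proof
    fix A assume A: "A \<in> sets ?P"
    then have "(\<lambda>x. x) -` A \<inter> ?S \<in> sigma_sets ?S ?E"
      using measurable_sets[OF *, of A] E by (simp add: space_measure_of)
    moreover have "A \<subseteq> ?S"
      using sets.sets_into_space[OF A] by (simp add: space_PiM)
    ultimately show "A \<in> sigma_sets ?S ?E"
      by (simp add: Int_absorb2)
  qed
  have "?E \<subseteq> sets ?P"
    using J by (auto intro!: sets_PiM_I_finite)
  then have "sigma_sets (space ?P) ?E \<subseteq> sets ?P"
    by (rule sets.sigma_sets_subset)
  then show "sigma_sets ?S ?E \<subseteq> sets ?P"
    by (simp add: space_PiM)
qed

text \<open>The indicator of a closed box is the pointwise limit of the products of the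
  functions \<open>max 0 (1 - n * infdist x C)\<close>; \<open>infdist x {} = 0\<close> forces the empty box apart.\<close>

lemma measure_PiM_eqI_continuous:
  fixes P Q :: "('a \<Rightarrow> real) measure"
  assumes J: "finite J"
    and P: "prob_space P" "sets P = sets (PiM J (\<lambda>_. borel))"
    and Q: "prob_space Q" "sets Q = sets (PiM J (\<lambda>_. borel))"
    and eq: "\<And>f. continuous_map (product_topology (\<lambda>_. euclideanreal) J) euclideanreal f \<Longrightarrow>
      bounded (f ` topspace (product_topology (\<lambda>_. euclideanreal) J)) \<Longrightarrow>
      (\<integral>x. f x \<partial>P) = (\<integral>x. f x \<partial>Q)"
  shows "P = Q"
proof (rule measure_eqI_generator_eq)
  let ?E = "{PiE J C | C. \<forall>j\<in>J. closed (C j)} :: ('a \<Rightarrow> real) set set"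
  let ?T = "product_topology (\<lambda>_. euclideanreal) J"
  show "Int_stable ?E"
    by (rule Int_stableI) (clarsimp simp: PiE_Int, metis (lifting) closed_Int)
  show "?E \<subseteq> Pow (PiE J (\<lambda>_. UNIV))"
    by (auto simp: PiE_iff)
  show "sets P = sigma_sets (PiE J (\<lambda>_. UNIV)) ?E" "sets Q = sigma_sets (PiE J (\<lambda>_. UNIV)) ?E"
    using P Q sets_PiM_borel_eq_closed_boxes[OF J] by simp_all
  show "range (\<lambda>_::nat. PiE J (\<lambda>_. UNIV)) \<subseteq> ?E" "(\<Union>i::nat. PiE J (\<lambda>_. UNIV)) = PiE J (\<lambda>_. UNIV)"
    by auto
  show "emeasure P (PiE J (\<lambda>_. UNIV)) \<noteq> \<infinity>"
    using P(1) by (simp add: finite_measure.emeasure_finite prob_space.finite_measure)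
  fix X assume "X \<in> ?E"
  then obtain C where X: "X = PiE J C" and C: "\<And>j. j \<in> J \<Longrightarrow> closed (C j)"
    by blast
  show "emeasure P X = emeasure Q X"
  proof (cases "X = {}")
    case False
    then have C0: "C j \<noteq> {}" if "j \<in> J" for j
      using that X by (auto simp: PiE_eq_empty_iff)
    define h where "h n x = (\<Prod>j\<in>J. max 0 (1 - real n * infdist (x j) (C j)))" for n and x :: "'a \<Rightarrow> real"
    have bnd: "\<bar>h n x\<bar> \<le> 1" for n x
      unfolding h_def abs_prod by (intro prod_le_1) (auto simp: infdist_nonneg)
    have cont: "continuous_map ?T euclideanreal (h n)" for n
      unfolding h_def
    proof (intro continuous_map_prod J)
      fix j assume j: "j \<in> J"
      have "continuous_map euclideanreal euclideanreal (\<lambda>y. max 0 (1 - real n * infdist y (C j)))"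
        by (simp, intro continuous_intros)
      from continuous_map_compose[OF continuous_map_product_projection[OF j] this]
      show "continuous_map ?T euclideanreal (\<lambda>x. max 0 (1 - real n * infdist (x j) (C j)))"
        by (simp add: o_def)
    qed
    have lim: "(\<lambda>n. h n x) \<longlonglongrightarrow> indicator X x" if x: "x \<in> PiE J (\<lambda>_. UNIV)" for x
    proof (cases "x \<in> X")
      case True
      then have "h n x = 1" for n
        unfolding h_def using X by (intro prod.neutral) (auto simp: PiE_iff)
      then show ?thesis
        using True by simp
    next
      case False
      then obtain j where j: "j \<in> J" "x j \<notin> C j"
        using x X by (auto simp: PiE_iff)
      \<comment> \<open>Outside the box some coordinate has positive distance to its closed side.
        The factor of that side is 0 from some \<open>n\<close> on, and the product with it.\<close>
      then have pos: "infdist (x j) (C j) > 0"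
        using C C0 by (metis in_closed_iff_infdist_zero infdist_nonneg order_le_less)
      have "\<forall>\<^sub>F n in sequentially. 1 < real n * infdist (x j) (C j)"
        using pos by real_asymp
      then have "\<forall>\<^sub>F n in sequentially. h n x = indicator X x"
      proof eventually_elim
        case (elim n)
        then show ?case
          unfolding h_def using J j False by (auto intro!: prod_zero bexI[of _ j])
      qed
      then show ?thesis
        by (rule tendsto_eventually)
    qed
    have conv: "(\<lambda>n. \<integral>x. h n x \<partial>R) \<longlonglongrightarrow> measure R X"
      if R: "prob_space R" "sets R = sets (PiM J (\<lambda>_. borel))" for R
    proof -
      interpret prob_space R by fact
      have sp: "space R = PiE J (\<lambda>_. UNIV)"
        using sets_eq_imp_space_eq[OF R(2)] by (simp add: space_PiM)
      have [measurable]: "h n \<in> borel_measurable R" for n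
        using borel_measurable_continuous_map_product[OF J cont[of n]] R(2)
        by (simp cong: measurable_cong_sets)
      have [measurable]: "X \<in> sets R"
        unfolding R(2) X using C by (intro sets_PiM_I_finite J) auto
      have "(\<lambda>n. \<integral>x. h n x \<partial>R) \<longlonglongrightarrow> (\<integral>x. indicator X x \<partial>R)"
        using lim bnd by (intro integral_dominated_convergence[where w="\<lambda>_. 1"]) (auto simp: sp)
      then show ?thesis
        by simp
    qed
    have "(\<integral>x. h n x \<partial>P) = (\<integral>x. h n x \<partial>Q)" for n
      using bnd by (intro eq cont) (auto intro!: boundedI[of _ 1])
    then have "measure P X = measure Q X"
      using conv[OF P] conv[OF Q] by (simp add: LIMSEQ_unique)
    then show ?thesis
      using P(1) Q(1) by (simp add: finite_measure.emeasure_eq_measure prob_space.finite_measure)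
  qed simp
qed


section \<open>Joint laws of processes rescaled in time and space\<close>

lemma measurable_fdd:
  assumes "\<And>t. t \<in> J \<Longrightarrow> Z t \<in> borel_measurable M"
  shows "(\<lambda>\<omega>. \<lambda>t\<in>J. Z t \<omega>) \<in> measurable M (PiM J (\<lambda>_. borel :: real measure))"
  using assms by (intro measurable_restrict) auto

lemma prob_space_fdd:
  assumes "prob_space M" "\<And>t. t \<in> J \<Longrightarrow> Z t \<in> borel_measurable M"
  shows "prob_space (fdd M Z J)"
  unfolding fdd_def using assms by (intro prob_space.prob_space_distr measurable_fdd)

lemma sets_fdd [simp]: "sets (fdd M Z J) = sets (PiM J (\<lambda>_. borel))"
  by (simp add: fdd_def)

text \<open>Expresses rescaling as one fixed map applied to the joint law at the times
  \<open>a * t\<close>, so that equalities and limits of laws can be pushed through this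
  map.\<close>

lemma fdd_rescale:
  assumes "\<And>t. t \<in> J \<Longrightarrow> Z (a * t) \<in> borel_measurable M"
  shows "fdd M (\<lambda>t \<omega>. k * Z (a * t) \<omega>) J =
    distr (fdd M Z ((*) a ` J)) (PiM J (\<lambda>_. borel)) (\<lambda>x. \<lambda>t\<in>J. k * x (a * t))"
proof -
  have "(\<lambda>x. \<lambda>t\<in>J. k * x (a * t)) \<in>
      measurable (PiM ((*) a ` J) (\<lambda>_. borel)) (PiM J (\<lambda>_. borel :: real measure))"
    by (intro measurable_restrict borel_measurable_times borel_measurable_const
        measurable_component_singleton) auto
  moreover have "(\<lambda>\<omega>. \<lambda>s\<in>(*) a ` J. Z s \<omega>) \<in> measurable M (PiM ((*) a ` J) (\<lambda>_. borel))"
    using assms by (intro measurable_fdd) auto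
  ultimately show ?thesis
    unfolding fdd_def by (subst distr_distr) (auto simp: o_def intro!: distr_cong restrict_ext)
qed

lemma fdd_eq_rescale:
  assumes "fdd_eq M Z M' Z'" "0 \<le> a"
    and "\<And>t. 0 \<le> t \<Longrightarrow> Z t \<in> borel_measurable M" "\<And>t. 0 \<le> t \<Longrightarrow> Z' t \<in> borel_measurable M'"
  shows "fdd_eq M (\<lambda>t \<omega>. k * Z (a * t) \<omega>) M' (\<lambda>t \<omega>. k * Z' (a * t) \<omega>)"
  unfolding fdd_eq_def
proof (intro allI impI)
  fix J :: "real set" assume J: "finite J \<and> J \<subseteq> {0..}"
  then have "finite ((*) a ` J) \<and> (*) a ` J \<subseteq> {0..}"
    using \<open>0 \<le> a\<close> by (auto simp: subset_eq)
  with assms(1) have "fdd M Z ((*) a ` J) = fdd M' Z' ((*) a ` J)"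
    by (simp add: fdd_eq_def)
  moreover have "0 \<le> a * t" if "t \<in> J" for t
    using J \<open>0 \<le> a\<close> that by (auto simp: subset_eq)
  ultimately show "fdd M (\<lambda>t \<omega>. k * Z (a * t) \<omega>) J = fdd M' (\<lambda>t \<omega>. k * Z' (a * t) \<omega>) J"
    using assms(3,4) by (simp add: fdd_rescale)
qed

section \<open>Convergence of finite-dimensional distributions\<close>

lemma weak_conv_on_cong:
  assumes "\<forall>\<^sub>F i in F. P i = P' i"
  shows "weak_conv_on T P Q F \<longleftrightarrow> weak_conv_on T P' Q F"
  unfolding weak_conv_on_def
  by (intro all_cong1 imp_cong refl tendsto_cong eventually_mono[OF assms]) auto

text \<open>The converging processes enter only through their joint laws, and only eventually along
  \<open>F\<close>. They may therefore be exchanged for others with the same laws, even on other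
  probability spaces.\<close>

lemma fdd_conv_cong:
  assumes "\<forall>\<^sub>F i in F. fdd_eq (N i) (Z i) (N' i) (Z' i)"
  shows "fdd_conv N Z M Y F \<longleftrightarrow> fdd_conv N' Z' M Y F"
  unfolding fdd_conv_def
  by (intro all_cong1 imp_cong refl weak_conv_on_cong eventually_mono[OF assms])
     (auto simp: fdd_eq_def)

lemma fdd_conv_const: "fdd_conv (\<lambda>_. M) (\<lambda>_. Y) M Y F"
  by (simp add: fdd_conv_def weak_conv_on_def)

text \<open>Substitution in a limit; it serves to replace the scale \<open>c\<close> by
  \<open>a * c\<close>.\<close>

lemma fdd_conv_filterlim:
  assumes "fdd_conv N Z M Y F" "filterlim g F G"
  shows "fdd_conv (\<lambda>i. N (g i)) (\<lambda>i. Z (g i)) M Y G"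
  unfolding fdd_conv_def weak_conv_on_def
proof (intro allI impI, elim conjE)
  fix J :: "real set" and f :: "(real \<Rightarrow> real) \<Rightarrow> real"
  assume "finite J" "J \<subseteq> {0..}"
    and "continuous_map (product_topology (\<lambda>_. euclideanreal) J) euclideanreal f"
    and "bounded (f ` topspace (product_topology (\<lambda>_. euclideanreal) J))"
  with assms(1) have "((\<lambda>i. \<integral>x. f x \<partial>fdd (N i) (Z i) J) \<longlongrightarrow> (\<integral>x. f x \<partial>fdd M Y J)) F"
    unfolding fdd_conv_def weak_conv_on_def by blast
  then show "((\<lambda>i. \<integral>x. f x \<partial>fdd (N (g i)) (Z (g i)) J) \<longlongrightarrow> (\<integral>x. f x \<partial>fdd M Y J)) G"
    using assms(2) by (rule filterlim_compose)
qed

text \<open>The continuous mapping theorem: if \<open>f\<close> is a test function on the target,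
  then \<open>f \<circ> \<phi>\<close> is one on the source, and a change of variables identifies
  the integrals.\<close>

lemma weak_conv_on_distr:
  assumes J: "finite J" and K: "finite K"
    and \<phi>: "continuous_map (product_topology (\<lambda>_. euclideanreal) J)
              (product_topology (\<lambda>_. euclideanreal) K) \<phi>"
    and "\<And>i. sets (P i) = sets (PiM J (\<lambda>_. borel))" "sets Q = sets (PiM J (\<lambda>_. borel))"
    and conv: "weak_conv_on (product_topology (\<lambda>_. euclideanreal) J) P Q F"
  shows "weak_conv_on (product_topology (\<lambda>_. euclideanreal) K)
    (\<lambda>i. distr (P i) (PiM K (\<lambda>_. borel)) \<phi>) (distr Q (PiM K (\<lambda>_. borel)) \<phi>) F"
  unfolding weak_conv_on_def
proof (intro allI impI, elim conjE)
  let ?T = "product_topology (\<lambda>_. euclideanreal)"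
  fix f :: "('b \<Rightarrow> real) \<Rightarrow> real"
  assume f: "continuous_map (?T K) euclideanreal f" and bdd: "bounded (f ` topspace (?T K))"
  \<comment> \<open>Each coordinate of \<open>\<phi>\<close> is a continuous real function, hence
    measurable, and this suffices for maps into a product.\<close>
  have \<phi>_meas: "\<phi> \<in> measurable (PiM J (\<lambda>_. borel)) (PiM K (\<lambda>_. borel))"
  proof (rule measurable_PiM_single')
    show "\<phi> \<in> space (PiM J (\<lambda>_. borel)) \<rightarrow> PiE K (\<lambda>_. space borel)"
      using continuous_map_funspace[OF \<phi>] by (simp add: space_PiM)
    fix k assume "k \<in> K"
    then have "continuous_map (?T J) euclideanreal (\<lambda>x. \<phi> x k)"
      using \<phi> by (simp add: continuous_map_componentwise)
    then show "(\<lambda>x. \<phi> x k) \<in> borel_measurable (PiM J (\<lambda>_. borel))"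
      by (rule borel_measurable_continuous_map_product[OF J])
  qed
  have int_eq: "(\<integral>x. f x \<partial>distr R (PiM K (\<lambda>_. borel)) \<phi>) = (\<integral>x. (f \<circ> \<phi>) x \<partial>R)"
    if "sets R = sets (PiM J (\<lambda>_. borel))" for R
    using \<phi>_meas borel_measurable_continuous_map_product[OF K f] that
    by (subst integral_distr[where N="PiM K (\<lambda>_. borel)"]) (simp_all add: comp_def cong: measurable_cong_sets)
  have "bounded ((f \<circ> \<phi>) ` topspace (?T J))"
    using continuous_map_image_subset_topspace[OF \<phi>]
    by (intro bounded_subset[OF bdd]) (auto simp: image_comp[symmetric])
  with conv continuous_map_compose[OF \<phi> f]
  have "((\<lambda>i. \<integral>x. (f \<circ> \<phi>) x \<partial>P i) \<longlongrightarrow> (\<integral>x. (f \<circ> \<phi>) x \<partial>Q)) F"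
    unfolding weak_conv_on_def by blast
  then show "((\<lambda>i. \<integral>x. f x \<partial>distr (P i) (PiM K (\<lambda>_. borel)) \<phi>) \<longlongrightarrow>
      (\<integral>x. f x \<partial>distr Q (PiM K (\<lambda>_. borel)) \<phi>)) F"
    by (simp only: int_eq assms(4,5))
qed

text \<open>The continuous mapping theorem for the map of \<open>fdd_rescale\<close>, which is
  continuous since its coordinates are multiples of projections. Measurability of \<open>Z i\<close>
  is asked only eventually, because scales \<open>c < 0\<close> would lead to negative times, where
  nothing is known.\<close>

lemma fdd_conv_rescale:
  assumes conv: "fdd_conv N Z M Y F" and a: "0 \<le> a"
    and Z: "\<forall>\<^sub>F i in F. \<forall>t\<ge>0. Z i t \<in> borel_measurable (N i)"
    and Y: "\<And>t. 0 \<le> t \<Longrightarrow> Y t \<in> borel_measurable M"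
  shows "fdd_conv N (\<lambda>i t \<omega>. k * Z i (a * t) \<omega>) M (\<lambda>t \<omega>. k * Y (a * t) \<omega>) F"
  unfolding fdd_conv_def
proof (intro allI impI, elim conjE)
  let ?T = "product_topology (\<lambda>_. euclideanreal)"
  fix J :: "real set" assume J: "finite J" "J \<subseteq> {0..}"
  let ?\<phi> = "\<lambda>x. \<lambda>t\<in>J. k * x (a * t)"
  have nonneg: "0 \<le> a * t" if "t \<in> J" for t
    using J a that by (auto simp: subset_eq)
  have "continuous_map (?T ((*) a ` J)) (?T J) ?\<phi>"
    unfolding continuous_map_componentwise
    by (auto intro!: continuous_map_real_mult_left continuous_map_product_projection)
  moreover have "weak_conv_on (?T ((*) a ` J)) (\<lambda>i. fdd (N i) (Z i) ((*) a ` J))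
      (fdd M Y ((*) a ` J)) F"
    using conv J nonneg by (auto simp: fdd_conv_def subset_eq)
  ultimately have "weak_conv_on (?T J)
      (\<lambda>i. distr (fdd (N i) (Z i) ((*) a ` J)) (PiM J (\<lambda>_. borel)) ?\<phi>)
      (distr (fdd M Y ((*) a ` J)) (PiM J (\<lambda>_. borel)) ?\<phi>) F"
    using J(1) by (intro weak_conv_on_distr[where J="(*) a ` J"]) auto
  moreover have "\<forall>\<^sub>F i in F. distr (fdd (N i) (Z i) ((*) a ` J)) (PiM J (\<lambda>_. borel)) ?\<phi> =
      fdd (N i) (\<lambda>t \<omega>. k * Z i (a * t) \<omega>) J"
    using Z by eventually_elim (use nonneg in \<open>simp add: fdd_rescale\<close>)
  ultimately show "weak_conv_on (?T J) (\<lambda>i. fdd (N i) (\<lambda>t \<omega>. k * Z i (a * t) \<omega>) J)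
      (fdd M (\<lambda>t \<omega>. k * Y (a * t) \<omega>) J) F"
    using Y nonneg by (simp add: fdd_rescale weak_conv_on_cong)
qed

text \<open>For each test function the two integrals are limits of the same real function along a
  nontrivial filter, so they agree; \<open>measure_PiM_eqI_continuous\<close> then identifies the
  laws. The two limits may live on different probability spaces.\<close>

lemma fdd_conv_unique:
  assumes "F \<noteq> bot" "fdd_conv N Z M Y F" "fdd_conv N Z M' Y' F"
    and "prob_space M" "\<And>t. 0 \<le> t \<Longrightarrow> Y t \<in> borel_measurable M"
    and "prob_space M'" "\<And>t. 0 \<le> t \<Longrightarrow> Y' t \<in> borel_measurable M'"
  shows "fdd_eq M Y M' Y'"
  unfolding fdd_eq_def
proof (intro allI impI, elim conjE)
  fix J :: "real set" assume J: "finite J" "J \<subseteq> {0..}"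
  show "fdd M Y J = fdd M' Y' J"
  proof (rule measure_PiM_eqI_continuous[OF J(1)])
    show "prob_space (fdd M Y J)" "prob_space (fdd M' Y' J)"
      using assms J by (auto intro!: prob_space_fdd)
    fix f :: "(real \<Rightarrow> real) \<Rightarrow> real"
    assume "continuous_map (product_topology (\<lambda>_. euclideanreal) J) euclideanreal f"
      and "bounded (f ` topspace (product_topology (\<lambda>_. euclideanreal) J))"
    with assms(2,3) J
    have "((\<lambda>i. \<integral>x. f x \<partial>fdd (N i) (Z i) J) \<longlongrightarrow> (\<integral>x. f x \<partial>fdd M Y J)) F"
      and "((\<lambda>i. \<integral>x. f x \<partial>fdd (N i) (Z i) J) \<longlongrightarrow> (\<integral>x. f x \<partial>fdd M' Y' J)) F"
      unfolding fdd_conv_def weak_conv_on_def by blast+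
    with \<open>F \<noteq> bot\<close> show "(\<integral>x. f x \<partial>fdd M Y J) = (\<integral>x. f x \<partial>fdd M' Y' J)"
      by (rule tendsto_unique)
  qed simp_all
qed

section \<open>Scaling of the parameter set and of the limit filters\<close>

lemma index_interval_scaled:
  assumes "index_interval \<Omega>" "\<mu> \<in> \<Omega>" "0 < c"
  shows "\<mu> * ereal c \<in> \<Omega>"
  using assms unfolding index_interval_def by (auto simp: mult.commute image_subset_iff)

text \<open>Continuity gives the limit 0, and the sign of \<open>a\<close> keeps
  \<open>a * c\<close> to the right of 0.\<close>

lemma filterlim_times_pos_at_right_0:
  fixes a :: real
  assumes "0 < a"
  shows "filterlim ((*) a) (at_right 0) (at_right 0)"
proof -
  have "((*) a \<longlongrightarrow> a * 0) (at_right 0)"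
    by (intro tendsto_intros)
  moreover have "\<forall>\<^sub>F c in at_right 0. a * c \<in> {0<..}"
    using eventually_at_right_less[of "0::real"] by eventually_elim (use assms in simp)
  ultimately show ?thesis
    by (auto simp: filterlim_at simp del: mult_eq_0_iff zero_less_mult_iff elim!: eventually_mono)
qed

section \<open>Self-similarity of scaling limits, and its converse\<close>

theorem theorem6p1:
  fixes H :: real and \<Omega> :: "ereal set"
    and M :: "ereal \<Rightarrow> 'a measure" and Y :: "ereal \<Rightarrow> real \<Rightarrow> 'a \<Rightarrow> real"
    and F :: "real filter"
  assumes "index_interval \<Omega>"
    and "process_family \<Omega> M Y"
    and "F = at_top \<or> F = at_right 0"
  shows "((\<exists>(N :: ereal \<Rightarrow> 'b measure) X.
              process_family \<Omega> N X \<and> lamperti_conv H \<Omega> N X M Y F)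
            \<longrightarrow> self_similar H \<Omega> M Y) \<and>
         (self_similar H \<Omega> M Y \<longrightarrow>
            (\<exists>(N :: ereal \<Rightarrow> 'a measure) X.
              process_family \<Omega> N X \<and> lamperti_conv H \<Omega> N X M Y F))"
proof -
  \<comment> \<open>The filters live on all reals, while the power laws for \<open>c\<close> and the
    closure of \<open>\<Omega>\<close> under scaling are available for positive
    \<open>c\<close>.\<close>
  have F_pos: "\<forall>\<^sub>F c in F. 0 < c"
    using assms(3) eventually_gt_at_top eventually_at_right_less by auto
  have F_times: "filterlim ((*) a) F F" if "0 < a" for a
    using assms(3) that filterlim_times_pos_at_right_0
      filterlim_tendsto_pos_mult_at_top[OF tendsto_const that filterlim_ident] by auto
  have F_bot: "F \<noteq> bot"
    using assms(3) by (elim disjE) simp_all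
  have Y: "prob_space (M \<mu>)" "0 \<le> t \<Longrightarrow> Y \<mu> t \<in> borel_measurable (M \<mu>)" if "\<mu> \<in> \<Omega>" for \<mu> t
    using assms(2) that by (auto simp: process_family_def)
  note scaled = index_interval_scaled[OF assms(1)]
  show ?thesis
  proof (intro conjI impI)
    assume "\<exists>(N :: ereal \<Rightarrow> 'b measure) X.
      process_family \<Omega> N X \<and> lamperti_conv H \<Omega> N X M Y F"
    then obtain N :: "ereal \<Rightarrow> 'b measure" and X
      where X: "process_family \<Omega> N X" and conv: "lamperti_conv H \<Omega> N X M Y F"
      by blast
    show "self_similar H \<Omega> M Y"
      unfolding self_similar_def
    proof (intro ballI allI impI)
      fix \<mu> and a :: real assume \<mu>: "\<mu> \<in> \<Omega>" and a: "0 < a"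
      define \<nu> where "\<nu> = \<mu> * ereal (a powr (H - 1))"
      have \<nu>: "\<nu> \<in> \<Omega>"
        unfolding \<nu>_def using \<mu> a by (intro scaled) auto
      \<comment> \<open>\<open>V \<kappa> c\<close> is the rescaled process at scale
        \<open>c\<close> whose limit is \<open>Y \<kappa>\<close>.\<close>
      define V where
        "V \<kappa> c t = (\<lambda>\<omega>. c powr (- H) * X (\<kappa> * ereal (c powr (H - 1))) (c * t) \<omega>)" for \<kappa> c t
      have V_conv: "fdd_conv (\<lambda>c. N (\<kappa> * ereal (c powr (H - 1)))) (V \<kappa>) (M \<kappa>) (Y \<kappa>) F"
        if "\<kappa> \<in> \<Omega>" for \<kappa>
        using conv that by (simp add: lamperti_conv_def V_def[abs_def])
      have V_meas: "\<forall>\<^sub>F c in F. \<forall>t\<ge>0. V \<kappa> c t \<in> borel_measurable (N (\<kappa> * ereal (c powr (H - 1))))"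
        if "\<kappa> \<in> \<Omega>" for \<kappa>
        using F_pos
      proof eventually_elim
        case (elim c)
        then have "\<kappa> * ereal (c powr (H - 1)) \<in> \<Omega>"
          using that by (intro scaled) auto
        with X have "X (\<kappa> * ereal (c powr (H - 1))) (c * t) \<in>
            borel_measurable (N (\<kappa> * ereal (c powr (H - 1))))" if "0 \<le> t" for t
          using elim that unfolding process_family_def by (meson less_imp_le mult_nonneg_nonneg)
        then show ?case
          unfolding V_def by (intro allI impI borel_measurable_times borel_measurable_const)
      qed
      have V_meas': "\<forall>\<^sub>F c in F. \<forall>t\<ge>0. V \<mu> (a * c) t \<in>
          borel_measurable (N (\<mu> * ereal ((a * c) powr (H - 1))))"
        by (rule eventually_compose_filterlim[OF V_meas[OF \<mu>] F_times[OF a]])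
      \<comment> \<open>Only time is scaled here, by \<open>a\<close>. In \<open>lim2\<close> the
        scale \<open>c\<close> is replaced by \<open>a * c\<close> and only space is scaled, by
        \<open>a powr H\<close>. The factors 1 fit both to the form of
        \<open>fdd_conv_rescale\<close>.\<close>
      have lim1: "fdd_conv (\<lambda>c. N (\<nu> * ereal (c powr (H - 1)))) (\<lambda>c t \<omega>. 1 * V \<nu> c (a * t) \<omega>)
          (M \<nu>) (\<lambda>t \<omega>. 1 * Y \<nu> (a * t) \<omega>) F"
        using a V_conv[OF \<nu>] V_meas[OF \<nu>] Y(2)[OF \<nu>] by (intro fdd_conv_rescale) auto
      have lim2: "fdd_conv (\<lambda>c. N (\<mu> * ereal ((a * c) powr (H - 1))))
          (\<lambda>c t \<omega>. a powr H * V \<mu> (a * c) (1 * t) \<omega>)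
          (M \<mu>) (\<lambda>t \<omega>. a powr H * Y \<mu> (1 * t) \<omega>) F"
        using fdd_conv_filterlim[OF V_conv[OF \<mu>] F_times[OF a]] V_meas' Y(2)[OF \<mu>]
        by (intro fdd_conv_rescale) auto
      have "\<forall>\<^sub>F c in F. fdd_eq
          (N (\<nu> * ereal (c powr (H - 1)))) (\<lambda>t \<omega>. 1 * V \<nu> c (a * t) \<omega>)
          (N (\<mu> * ereal ((a * c) powr (H - 1)))) (\<lambda>t \<omega>. a powr H * V \<mu> (a * c) (1 * t) \<omega>)"
        using F_pos
      proof eventually_elim
        case (elim c)
        \<comment> \<open>The powers of \<open>a\<close> and \<open>c\<close> in the parameter
          combine to a power of \<open>a * c\<close>, and \<open>c powr (- H)\<close> equals
          \<open>a powr H * (a * c) powr (- H)\<close>. So the two processes coincide pointwise, not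
          merely in law.\<close>
        have *: "\<nu> * ereal (c powr (H - 1)) = \<mu> * ereal ((a * c) powr (H - 1))"
          using a elim by (simp add: \<nu>_def powr_mult mult.assoc)
        have "1 * V \<nu> c (a * t) \<omega> = a powr H * V \<mu> (a * c) (1 * t) \<omega>" for t \<omega>
          using a elim unfolding V_def * by (simp add: powr_mult powr_minus mult_ac)
        then show ?case
          unfolding * by (simp add: fdd_eq_def)
      qed
      with lim2 have lim2': "fdd_conv (\<lambda>c. N (\<nu> * ereal (c powr (H - 1))))
          (\<lambda>c t \<omega>. 1 * V \<nu> c (a * t) \<omega>) (M \<mu>) (\<lambda>t \<omega>. a powr H * Y \<mu> (1 * t) \<omega>) F"
        by (simp only: fdd_conv_cong)
      have "fdd_eq (M \<nu>) (\<lambda>t \<omega>. 1 * Y \<nu> (a * t) \<omega>) (M \<mu>) (\<lambda>t \<omega>. a powr H * Y \<mu> (1 * t) \<omega>)"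
        using a \<mu> \<nu> Y
        by (intro fdd_conv_unique[OF F_bot lim1 lim2']) (auto intro!: borel_measurable_times)
      then show "fdd_eq (M (\<mu> * ereal (a powr (H - 1))))
          (\<lambda>t. Y (\<mu> * ereal (a powr (H - 1))) (a * t)) (M \<mu>) (\<lambda>t \<omega>. a powr H * Y \<mu> t \<omega>)"
        by (simp add: \<nu>_def)
    qed
  next
    assume self_sim: "self_similar H \<Omega> M Y"
    \<comment> \<open>The witness for \<open>X\<close> is \<open>Y\<close> itself, on its own
      probability spaces.\<close>
    have "lamperti_conv H \<Omega> M Y M Y F"
      unfolding lamperti_conv_def
    proof
      fix \<mu> assume \<mu>: "\<mu> \<in> \<Omega>"
      have "\<forall>\<^sub>F c in F. fdd_eq
          (M (\<mu> * ereal (c powr (H - 1))))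
          (\<lambda>t \<omega>. c powr (- H) * Y (\<mu> * ereal (c powr (H - 1))) (c * t) \<omega>) (M \<mu>) (Y \<mu>)"
        using F_pos
      proof eventually_elim
        case (elim c)
        let ?\<nu> = "\<mu> * ereal (c powr (H - 1))"
        have \<nu>: "?\<nu> \<in> \<Omega>"
          using \<mu> elim by (intro scaled) auto
        have "fdd_eq (M ?\<nu>) (\<lambda>t. Y ?\<nu> (c * t)) (M \<mu>) (\<lambda>t \<omega>. c powr H * Y \<mu> t \<omega>)"
          using self_sim \<mu> elim by (simp add: self_similar_def)
        \<comment> \<open>Self-similarity is multiplied by \<open>c powr (- H)\<close>, which
          cancels the factor on the right; time is left alone, hence \<open>1 * t\<close>.\<close>
        then have "fdd_eq (M ?\<nu>) (\<lambda>t \<omega>. c powr (- H) * Y ?\<nu> (c * (1 * t)) \<omega>)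
            (M \<mu>) (\<lambda>t \<omega>. c powr (- H) * (c powr H * Y \<mu> (1 * t) \<omega>))"
          using elim Y(2)[OF \<mu>] Y(2)[OF \<nu>]
          by (intro fdd_eq_rescale) (auto intro!: borel_measurable_times)
        moreover have "c powr (- H) * (c powr H * y) = y" for y
          using elim by (simp add: powr_minus)
        ultimately show ?case
          by simp
      qed
      \<comment> \<open>Along \<open>F\<close> the rescaled process may now be replaced by the
        family constantly equal to \<open>Y \<mu>\<close>, whose convergence is trivial.\<close>
      then show "fdd_conv (\<lambda>c. M (\<mu> * ereal (c powr (H - 1))))
          (\<lambda>c t \<omega>. c powr (- H) * Y (\<mu> * ereal (c powr (H - 1))) (c * t) \<omega>) (M \<mu>) (Y \<mu>) F"
        by (simp add: fdd_conv_cong fdd_conv_const)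
    qed
    with assms(2) show "\<exists>(N :: ereal \<Rightarrow> 'a measure) X.
        process_family \<Omega> N X \<and> lamperti_conv H \<Omega> N X M Y F"
      by blast
  qed
qed

end
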